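(* Let $n\ge d$ be positive integers, $L=\{\ell_1,\dots,\ell_n\}$, $R=\{r_1,\dots,r_d\}$, and let $\mathcal{M}=(M_\sigma)$ be a linkage $(n,d)$-matching field on $L\sqcup R$. Then the map sending each $(n-d+1)$-subset $\rho\subseteq L$ to the right degree vector of the Chow covector $\Omega_\rho$ is a bijection from $\binom{L}{n-d+1}$ onto the set of lattice points of the dilated simplex $(n-d+1)\Delta_{d-1}$, i.e. onto $\{v\in\mathbb{Z}_{\ge 0}^d : v_1+\dots+v_d=n-d+1\}$.
   Context: All graphs are bipartite graphs on the node set $L\sqcup R$ (edges join a node of $L$ to a node of $R$), identified with their edge sets. The right degree vector of a graph is $(\deg r_1,\dots,\deg r_d)$. An $(n,d)$-matching field $\mathcal{M}=(M_\sigma)$ assigns to every $d$-subset $\sigma\subseteq L$ a perfect matching $M_\sigma$ between $\sigma$ and $R$. It is linkage if for every $r_i\in R$ and every $(d+1)$-subset $\tau\subseteq L$ there exist distinct $\ell_j,\ell_{j'}\in\tau$ such that $M_{\tau\setminus\{\ell_j\}}$ and $M_{\tau\setminus\{\ell_{j'}\}}$ agree everywhere except on the edges incident with $r_i$. For an $(n-d+1)$-subset $\rho\subseteq L$, the Chow covector $\Omega_\rho$ is the graph with edge set $\{(\ell_j,r) : \ell_j\in\rho\}$, where $r$ is the node matched to $\ell_j$ in $M_{(L\setminus\rho)\cup\{\ell_j\}}$. *)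

theory Defs
  imports Main
begin

text \<open>Nodes: L = {0..<n} (l_j is j), R = {0..<d} (r_i is i).
  A bipartite graph is a set of edges (l, r) with l in L and r in R.\<close>

definition perfect_matching :: "nat set \<Rightarrow> nat set \<Rightarrow> (nat \<times> nat) set \<Rightarrow> bool" where
  "perfect_matching \<sigma> R E \<longleftrightarrow> E \<subseteq> \<sigma> \<times> R \<and>
     (\<forall>l\<in>\<sigma>. \<exists>!r. (l, r) \<in> E) \<and> (\<forall>r\<in>R. \<exists>!l. (l, r) \<in> E)"

definition matching_field :: "nat \<Rightarrow> nat \<Rightarrow> (nat set \<Rightarrow> (nat \<times> nat) set) \<Rightarrow> bool" where
  "matching_field n d M \<longleftrightarrow>
     (\<forall>\<sigma>. \<sigma> \<subseteq> {0..<n} \<and> card \<sigma> = d \<longrightarrow> perfect_matching \<sigma> {0..<d} (M \<sigma>))"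

definition away_from :: "nat \<Rightarrow> (nat \<times> nat) set \<Rightarrow> (nat \<times> nat) set" where
  "away_from r E = {e \<in> E. snd e \<noteq> r}"

definition linkage :: "nat \<Rightarrow> nat \<Rightarrow> (nat set \<Rightarrow> (nat \<times> nat) set) \<Rightarrow> bool" where
  "linkage n d M \<longleftrightarrow> matching_field n d M \<and>
     (\<forall>r\<in>{0..<d}. \<forall>\<tau>. \<tau> \<subseteq> {0..<n} \<and> card \<tau> = d + 1 \<longrightarrow>
        (\<exists>lj\<in>\<tau>. \<exists>lj'\<in>\<tau>. lj \<noteq> lj' \<and>
           away_from r (M (\<tau> - {lj})) = away_from r (M (\<tau> - {lj'}))))"

definition chow_covector :: "nat \<Rightarrow> (nat set \<Rightarrow> (nat \<times> nat) set) \<Rightarrow> nat set \<Rightarrow> (nat \<times> nat) set" where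
  "chow_covector n M \<rho> = {(l, r). l \<in> \<rho> \<and> (l, r) \<in> M (({0..<n} - \<rho>) \<union> {l})}"

definition right_degree_vector :: "nat \<Rightarrow> (nat \<times> nat) set \<Rightarrow> nat list" where
  "right_degree_vector d G = map (\<lambda>i. card {l. (l, i) \<in> G}) [0..<d]"

end

theory Submission
  imports Defs
begin

text \<open>
  Generalise matchings on \<open>d\<close>-sets to topes of type \<open>u\<close>: functions on sets of size \<open>\<Sum>u\<close> whose fibre
  over \<open>r\<close> has \<open>u r\<close> elements. In a linkage field of such topes, those on the subsets of \<open>\<tau>\<close> of
  codimension one all lie in one spanning tree with right degrees \<open>u + 1\<close>. Joining every
  neighbour of \<open>i\<close> in that tree to \<open>i\<close> yields a tope of type \<open>u + e\<^sub>i\<close>, and these again form a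
  linkage field. If \<open>\<rho>\<close> has covector degree \<open>v - e\<^sub>i\<close> in the new field, adding to \<open>\<rho>\<close> any element
  that the old tope on \<open>L - \<rho>\<close> sends to \<open>i\<close> gives a set of covector degree \<open>v\<close> in the old one.
  Induction on \<open>\<Sum>v\<close> therefore shows surjectivity, and both sides have
  \<open>n choose (n - d + 1)\<close> elements.
\<close>

section \<open>The tree of topes, explored from a left node\<close>

text \<open>\<open>T m\<close> is the tope on \<open>A - {m}\<close> and \<open>G r\<close> the common extension, of type \<open>u + e\<^sub>r\<close>, of those with
  \<open>m\<close> in its fibre over \<open>r\<close>. The edges of the tree are the pairs \<open>(l, r)\<close> with \<open>G r l = r\<close>.\<close>

locale linkage_tree =
  fixes A :: "'l set" and R :: "'r set" and u :: "'r \<Rightarrow> nat"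
    and T :: "'l \<Rightarrow> 'l \<Rightarrow> 'r" and G :: "'r \<Rightarrow> 'l \<Rightarrow> 'r"
  assumes finite_A: "finite A" and finite_R: "finite R"
    and T_R: "\<lbrakk>m \<in> A; l \<in> A; l \<noteq> m\<rbrakk> \<Longrightarrow> T m l \<in> R"
    and T_card: "\<lbrakk>m \<in> A; r \<in> R\<rbrakk> \<Longrightarrow> card {l \<in> A - {m}. T m l = r} = u r"
    and G_card: "r \<in> R \<Longrightarrow> card {l \<in> A. G r l = r} = Suc (u r)"
    and G_T: "\<lbrakk>r \<in> R; j \<in> A; G r j = r; l \<in> A; l \<noteq> j\<rbrakk> \<Longrightarrow> T j l = G r l"
begin

definition S :: "'r \<Rightarrow> 'l set" where
  "S r = {l \<in> A. G r l = r}"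

definition reached :: "'l \<Rightarrow> 'r set \<Rightarrow> 'l set" where
  "reached m Q = insert m {l \<in> A. l \<noteq> m \<and> T m l \<in> Q}"

text \<open>A search of the tree from \<open>m\<close>: a right node may be added once one of its
  neighbours is reached. Connectedness of the tree is the statement that the search can exhaust
  \<open>R\<close>.\<close>

inductive grow :: "'l \<Rightarrow> 'r set \<Rightarrow> bool" for m where
  empty: "grow m {}"
| insert: "\<lbrakk>grow m Q; r \<in> R - Q; j \<in> S r; j \<in> reached m Q\<rbrakk> \<Longrightarrow> grow m (insert r Q)"

text \<open>The fibre of \<open>T m\<close> over \<open>r\<close> has one element less than
  \<open>S r\<close>, so \<open>j\<close> is the only neighbour of \<open>r\<close> missing from it:
  the neighbour on the way to \<open>m\<close>.\<close>

lemma S_insert: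
  assumes m: "m \<in> A" and r: "r \<in> R" and j: "j \<in> S r" "j = m \<or> T m j \<noteq> r"
    and sub: "{l \<in> A - {m}. T m l = r} \<subseteq> S r"
  shows "S r = insert j {l \<in> A - {m}. T m l = r}"
proof -
  let ?B = "{l \<in> A - {m}. T m l = r}"
  have fin: "finite (S r)" "finite ?B" using finite_A by (auto simp: S_def)
  have "j \<notin> ?B" using j by auto
  then have "card (insert j ?B) = card (S r)"
    using T_card[OF m r] G_card[OF r] fin by (simp add: S_def)
  moreover have "insert j ?B \<subseteq> S r" using sub j by blast
  ultimately show ?thesis using card_subset_eq[OF fin(1)] by metis
qed

lemma S_T: "\<lbrakk>r \<in> R; j \<in> S r; l \<in> A; l \<noteq> j\<rbrakk> \<Longrightarrow> T j l = G r l"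
  using G_T[of r j l] by (simp add: S_def)

text \<open>Leaving \<open>m\<close> along the tree, \<open>T j\<close> is obtained from \<open>T m\<close> by switching the edges of the path,
  so a part of the tree not yet reached looks the same from \<open>j\<close> and from \<open>m\<close>.\<close>

lemma grow_invariant:
  assumes m: "m \<in> A"
  shows "grow m Q \<Longrightarrow> (\<forall>r\<in>Q. {l \<in> A - {m}. T m l = r} \<subseteq> S r) \<and>
    (\<forall>j\<in>reached m Q. \<forall>l\<in>A - {j}. if l \<in> reached m Q then T j l \<in> Q else T j l = T m l)"
proof (induction rule: grow.induct)
  case empty
  then show ?case by (auto simp: reached_def)
next
  case (insert Q r j)
  let ?B = "{l \<in> A - {m}. T m l = r}"
  have r: "r \<in> R" "r \<notin> Q" and jA: "j \<in> A" using insert by (auto simp: S_def)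
  have inv: "\<And>j l. \<lbrakk>j \<in> reached m Q; l \<in> A; l \<noteq> j\<rbrakk> \<Longrightarrow>
      if l \<in> reached m Q then T j l \<in> Q else T j l = T m l"
    using insert.IH by blast
  \<comment> \<open>Such an \<open>l\<close> is not yet reached, so \<open>T j l = T m l = r\<close>
    by the invariant, while \<open>T j\<close> agrees with \<open>G r\<close> off
    \<open>j\<close>.\<close>
  have B: "l \<in> S r" if "l \<in> ?B" for l
  proof -
    have nr: "l \<notin> reached m Q" using that r by (auto simp: reached_def)
    then have "l \<noteq> j" using insert.hyps by auto
    then have "T j l = r" using inv[OF insert.hyps(4), of l] nr that by auto
    then show ?thesis using S_T[OF r(1) insert.hyps(3)] that \<open>l \<noteq> j\<close> by (auto simp: S_def)
  qed
  have reach: "reached m (insert r Q) = reached m Q \<union> ?B"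
    by (auto simp: reached_def)
  have new: "if l \<in> reached m (insert r Q) then T j' l \<in> insert r Q else T j' l = T m l"
    if j': "j' \<in> reached m (insert r Q)" and l: "l \<in> A" "l \<noteq> j'" for j' l
  proof (cases "j' \<in> reached m Q")
    case True
    then show ?thesis using inv[OF True l] reach by (auto split: if_splits)
  next
    case False
    then have j'B: "j' \<in> ?B" using j' reach by auto
    then have j'S: "j' \<in> S r" using B by blast
    have jj: "j' \<noteq> j" using False insert.hyps by auto
    have eq: "T j' l = G r l" using S_T[OF r(1) j'S l] .
    show ?thesis
    proof (cases "l = j")
      case True
      then show ?thesis using eq insert.hyps reach by (auto simp: S_def)
    next
      case lj: False
      show ?thesis
      proof (cases "l \<in> ?B")
        case True
        then have "G r l = r" using B by (auto simp: S_def)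
        then show ?thesis using eq True reach by auto
      next
        case False
        then have iff: "l \<in> reached m (insert r Q) \<longleftrightarrow> l \<in> reached m Q" using reach by blast
        \<comment> \<open>Two neighbours of \<open>r\<close> see every third left node through the
          same \<open>G r\<close>, so the claim for \<open>j'\<close> reduces to that for
          \<open>j\<close>.\<close>
        have "T j' l = T j l" using S_T[OF r(1) insert.hyps(3) l(1) lj] eq by simp
        then show ?thesis
          using inv[OF insert.hyps(4) l(1) lj] unfolding iff by (metis insertI2)
      qed
    qed
  qed
  have "{l \<in> A - {m}. T m l = c} \<subseteq> S c" if "c \<in> insert r Q" for c
  proof (cases "c = r")
    case True
    then show ?thesis using B by (intro subsetI) simp
  next
    case False
    then show ?thesis using insert.IH that by simp
  qed
  then show ?case using new by (intro conjI ballI) blast+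
qed

section \<open>Connectedness of the tree\<close>

lemma obtain_maximal_grow:
  assumes "P \<subseteq> R"
  obtains Q where "grow m Q" "Q \<subseteq> P" "\<And>r j. \<lbrakk>r \<in> P - Q; j \<in> S r\<rbrakk> \<Longrightarrow> j \<notin> reached m Q"
proof -
  have finP: "finite P" using assms finite_R finite_subset by blast
  have "\<exists>Q. (grow m Q \<and> Q \<subseteq> P) \<and> (\<forall>Q'. grow m Q' \<and> Q' \<subseteq> P \<longrightarrow> card Q' \<le> card Q)"
  proof (rule ex_has_greatest_nat[where b = "Suc (card P)"])
    show "grow m {} \<and> {} \<subseteq> P" by (simp add: grow.empty)
    show "\<forall>Q. grow m Q \<and> Q \<subseteq> P \<longrightarrow> card Q < Suc (card P)"
      using card_mono finP by (auto simp: less_Suc_eq_le)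
  qed
  then obtain Q where Q: "grow m Q" "Q \<subseteq> P"
    and max: "\<And>Q'. \<lbrakk>grow m Q'; Q' \<subseteq> P\<rbrakk> \<Longrightarrow> card Q' \<le> card Q" by blast
  have "j \<notin> reached m Q" if "r \<in> P - Q" "j \<in> S r" for r j
  proof
    assume "j \<in> reached m Q"
    then have "grow m (insert r Q)" using that assms Q by (auto intro: grow.insert)
    then have "card (insert r Q) \<le> card Q" using that Q max by blast
    moreover have "finite Q" using Q finP finite_subset by blast
    ultimately show False using that by simp
  qed
  then show thesis using that Q by blast
qed

lemma card_T_preimage:
  assumes "m \<in> A" "Q \<subseteq> R"
  shows "card {l \<in> A. l \<noteq> m \<and> T m l \<in> Q} = sum u Q"
proof -
  have "{l \<in> A. l \<noteq> m \<and> T m l \<in> Q} = (\<Union>r\<in>Q. {l \<in> A - {m}. T m l = r})" by auto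
  also have "card \<dots> = (\<Sum>r\<in>Q. card {l \<in> A - {m}. T m l = r})"
    using assms finite_R finite_A by (intro card_UN_disjoint) (auto intro: finite_subset)
  also have "\<dots> = sum u Q"
    using assms by (intro sum.cong refl T_card) auto
  finally show ?thesis .
qed

lemma card_reached:
  assumes "m \<in> A" "Q \<subseteq> R"
  shows "card (reached m Q) = Suc (sum u Q)"
  unfolding reached_def using card_T_preimage[OF assms] finite_A by simp

text \<open>Hall's condition with one element to spare. A maximal growth inside \<open>P\<close>
  reaches \<open>Suc (sum u Q)\<close> left nodes, all in the sets \<open>S r\<close> over
  \<open>Q\<close>; by maximality the other sets avoid them, and induction handles
  \<open>P - Q\<close>.\<close>

lemma card_Union_S:
  assumes "P \<subseteq> R" "P \<noteq> {}"
  shows "sum u P < card (\<Union>r\<in>P. S r)"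
  using assms
proof (induction "card P" arbitrary: P rule: less_induct)
  case less
  have finP: "finite P" using less finite_R finite_subset by blast
  obtain r0 where r0: "r0 \<in> P" using less by blast
  have "card (S r0) \<noteq> 0" using G_card[of r0] r0 less.prems by (auto simp: S_def)
  then have "S r0 \<noteq> {}" by force
  then obtain m where m: "m \<in> S r0" by blast
  have mA: "m \<in> A" using m by (simp add: S_def)
  obtain Q where Q: "grow m Q" "Q \<subseteq> P"
    and max: "\<And>r j. \<lbrakk>r \<in> P - Q; j \<in> S r\<rbrakk> \<Longrightarrow> j \<notin> reached m Q"
    using obtain_maximal_grow[OF less.prems(1)] by blast
  \<comment> \<open>The start \<open>m\<close> is a neighbour of \<open>r0\<close>, so growth cannot
    stop before adding \<open>r0\<close>. This makes \<open>P - Q\<close> smaller than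
    \<open>P\<close>.\<close>
  have r0Q: "r0 \<in> Q" using max[of r0 m] r0 m by (auto simp: reached_def)
  have inv: "l \<in> S (T m l)" if "l \<in> A" "l \<noteq> m" "T m l \<in> Q" for l
    using grow_invariant[OF mA Q(1)] that by blast
  have QR: "Q \<subseteq> R" using Q less by blast
  have sub: "reached m Q \<subseteq> (\<Union>r\<in>Q. S r)" using inv r0Q m by (auto simp: reached_def)
  have fin: "finite (\<Union>r\<in>P. S r)" using finP finite_A by (auto simp: S_def)
  have rest: "sum u (P - Q) \<le> card (\<Union>r\<in>P - Q. S r)"
  proof (cases "P - Q = {}")
    case True
    then show ?thesis by (metis le0 sum.empty)
  next
    case False
    have "card (P - Q) < card P" using r0Q r0 finP by (intro psubset_card_mono) auto
    moreover have "P - Q \<subseteq> R" using less.prems by blast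
    ultimately show ?thesis using less.hyps[of "P - Q"] False by simp
  qed
  have "sum u P = sum u Q + sum u (P - Q)"
    using sum.subset_diff[OF Q(2) finP] by (simp add: add.commute)
  also have "\<dots> < card (reached m Q) + card (\<Union>r\<in>P - Q. S r)"
    using card_reached[OF mA QR] rest by simp
  also have "\<dots> = card (reached m Q \<union> (\<Union>r\<in>P - Q. S r))"
  proof (rule card_Un_disjoint[symmetric])
    show "finite (reached m Q)" using finite_A by (simp add: reached_def)
    show "finite (\<Union>r\<in>P - Q. S r)" using fin by (rule rev_finite_subset) blast
    show "reached m Q \<inter> (\<Union>r\<in>P - Q. S r) = {}" using max by blast
  qed
  also have "\<dots> \<le> card (\<Union>r\<in>P. S r)"
    using sub Q fin by (intro card_mono) blast+
  finally show ?case .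
qed

text \<open>If growth stopped at \<open>Q\<close>, all neighbours of the nodes in
  \<open>R - Q\<close> would be unreached, hence sent into \<open>R - Q\<close> by
  \<open>T m\<close>. Only \<open>sum u (R - Q)\<close> nodes are, fewer than
  \<open>card_Union_S\<close> demands.\<close>

lemma grow_all:
  assumes m: "m \<in> A"
  shows "grow m R"
proof -
  obtain Q where Q: "grow m Q" "Q \<subseteq> R"
    and max: "\<And>r j. \<lbrakk>r \<in> R - Q; j \<in> S r\<rbrakk> \<Longrightarrow> j \<notin> reached m Q"
    using obtain_maximal_grow[of R] by blast
  have "R - Q = {}"
  proof (rule ccontr)
    assume ne: "R - Q \<noteq> {}"
    have "(\<Union>r\<in>R - Q. S r) \<subseteq> {l \<in> A. l \<noteq> m \<and> T m l \<in> R - Q}"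
    proof
      fix l assume "l \<in> (\<Union>r\<in>R - Q. S r)"
      then have "l \<in> A" "l \<notin> reached m Q" using max by (auto simp: S_def)
      then show "l \<in> {l \<in> A. l \<noteq> m \<and> T m l \<in> R - Q}"
        using T_R[OF m] by (auto simp: reached_def)
    qed
    then have "card (\<Union>r\<in>R - Q. S r) \<le> sum u (R - Q)"
      unfolding card_T_preimage[OF m Diff_subset, symmetric] using finite_A by (intro card_mono) auto
    then show False using card_Union_S[of "R - Q"] ne by auto
  qed
  then show ?thesis using Q by (metis Diff_eq_empty_iff subset_antisym)
qed

text \<open>Once growth exhausts \<open>R\<close>, the invariant covers every fibre: each tope
  consists of tree edges.\<close>

lemma T_in_S:
  assumes "m \<in> A" "l \<in> A" "l \<noteq> m"
  shows "l \<in> S (T m l)"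
proof -
  have "{l \<in> A - {m}. T m l = T m l'} \<subseteq> S (T m l')" if "T m l' \<in> R" for l'
    using grow_invariant[OF assms(1) grow_all[OF assms(1)]] that by (rule conjunct1[THEN bspec])
  from this[OF T_R[OF assms]] show ?thesis using assms by auto
qed

lemma G_T_eq: "\<lbrakk>m \<in> A; l \<in> A; l \<noteq> m\<rbrakk> \<Longrightarrow> G (T m l) l = T m l"
  using T_in_S by (simp add: S_def)

text \<open>In the tree, \<open>q\<close> lies on the path from \<open>p\<close> to \<open>s\<close>, and \<open>T m p\<close> is the first node on the path
  from \<open>p\<close> to \<open>m\<close>.\<close>

lemma T_switch:
  assumes "s \<in> A" "p \<in> A" "q \<in> A" "p \<noteq> s" "q \<noteq> s" "q \<noteq> p"
    and "T s q \<noteq> T p q"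
  shows "T s p = T q p"
proof -
  \<comment> \<open>Induction on the growth from \<open>s\<close>, with \<open>j\<close> ranging
    over the candidates for \<open>p\<close> reached so far.\<close>
  have "grow s Q \<Longrightarrow> \<forall>j\<in>reached s Q. \<forall>q\<in>A. j \<noteq> s \<and> q \<noteq> s \<and> q \<noteq> j \<and> T s q \<noteq> T j q \<longrightarrow> T s j = T q j" for Q
  proof (induction rule: grow.induct)
    case empty
    then show ?case by (auto simp: reached_def)
  next
    case (insert Q r j)
    have r: "r \<in> R" "r \<notin> Q" using insert.hyps by auto
    show ?case
    proof (intro ballI impI)
      fix j' q
      assume j': "j' \<in> reached s (insert r Q)" and q: "q \<in> A"
        and a: "j' \<noteq> s \<and> q \<noteq> s \<and> q \<noteq> j' \<and> T s q \<noteq> T j' q"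
      show "T s j' = T q j'"
      proof (cases "j' \<in> reached s Q")
        case True
        then show ?thesis using insert.IH q a by blast
      next
        case False
        then have j'r: "j' \<in> A" "T s j' = r" using j' a by (auto simp: reached_def)
        have j'S: "j' \<in> S r" using T_in_S[OF assms(1) j'r(1)] a j'r by simp
        have jj: "j \<noteq> j'" using False insert.hyps by auto
        show ?thesis
        proof (cases "q = j")
          case True
          have "T j j' = G r j'" using S_T[OF r(1) insert.hyps(3) j'r(1)] jj by auto
          then show ?thesis using j'S j'r True by (simp add: S_def)
        next
          case qj: False
          \<comment> \<open>Both are neighbours of \<open>r\<close> and see \<open>q\<close> alike,
            so the hypothesis passes from \<open>j'\<close> to \<open>j\<close>, which was reached
            earlier.\<close>
          have "T j' q = T j q"
            using S_T[OF r(1) insert.hyps(3) q qj] S_T[OF r(1) j'S q] a by simp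
          then have "j \<noteq> s" "T s j = T q j"
            using insert.IH insert.hyps(4) q a qj by auto
          \<comment> \<open>The value \<open>T q j = T s j\<close> lies in \<open>Q\<close>, so the
            fibre of \<open>T q\<close> over \<open>r\<close> misses \<open>j\<close>, hence nothing
            else of \<open>S r\<close>; thus it contains \<open>j'\<close>.\<close>
          then have "T q j \<noteq> r" using insert.hyps(4) r by (auto simp: reached_def)
          then have "S r = insert j {l \<in> A - {q}. T q l = r}"
            using T_in_S[OF q] by (intro S_insert[OF q r(1) insert.hyps(3)]) auto
          then show ?thesis using j'S jj j'r by auto
        qed
      qed
    qed
  qed
  from this[OF grow_all[OF assms(1)]] show ?thesis
    using assms T_R[OF assms(1,2)] by (auto simp: reached_def)
qed

end

section \<open>Linkage fields of topes and their extensions\<close>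

locale linked_field =
  fixes L :: "'l set" and R :: "'r set" and u :: "'r \<Rightarrow> nat"
    and T :: "'l set \<Rightarrow> 'l \<Rightarrow> 'r" and F :: "'r \<Rightarrow> 'l set \<Rightarrow> 'l \<Rightarrow> 'r"
  assumes finite_L: "finite L" and finite_R: "finite R"
    and u_pos: "r \<in> R \<Longrightarrow> 0 < u r"
    and T_R: "\<lbrakk>\<sigma> \<subseteq> L; card \<sigma> = sum u R; l \<in> \<sigma>\<rbrakk> \<Longrightarrow> T \<sigma> l \<in> R"
    and T_card: "\<lbrakk>\<sigma> \<subseteq> L; card \<sigma> = sum u R; r \<in> R\<rbrakk> \<Longrightarrow> card {l \<in> \<sigma>. T \<sigma> l = r} = u r"
    and F_card: "\<lbrakk>\<tau> \<subseteq> L; card \<tau> = Suc (sum u R); r \<in> R\<rbrakk> \<Longrightarrow>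
      card {l \<in> \<tau>. F r \<tau> l = r} = Suc (u r)"
    and F_T: "\<lbrakk>\<tau> \<subseteq> L; card \<tau> = Suc (sum u R); r \<in> R; j \<in> \<tau>; F r \<tau> j = r; l \<in> \<tau>; l \<noteq> j\<rbrakk>
      \<Longrightarrow> T (\<tau> - {j}) l = F r \<tau> l"
begin

lemma tree:
  assumes "\<tau> \<subseteq> L" "card \<tau> = Suc (sum u R)"
  shows "linkage_tree \<tau> R u (\<lambda>m. T (\<tau> - {m})) (\<lambda>r. F r \<tau>)"
proof
  show "finite \<tau>" using assms finite_L finite_subset by blast
  then have c: "card (\<tau> - {m}) = sum u R" "\<tau> - {m} \<subseteq> L" if "m \<in> \<tau>" for m
    using assms that by auto
  show "T (\<tau> - {m}) l \<in> R" if "m \<in> \<tau>" "l \<in> \<tau>" "l \<noteq> m" for m l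
    using T_R[OF c(2,1)] that by auto
  show "card {l \<in> \<tau> - {m}. T (\<tau> - {m}) l = r} = u r" if "m \<in> \<tau>" "r \<in> R" for m r
    using T_card[OF c(2,1)] that by auto
  show "finite R" by (rule finite_R)
  show "card {l \<in> \<tau>. F r \<tau> l = r} = Suc (u r)" if "r \<in> R" for r
    by (rule F_card[OF assms that])
  show "T (\<tau> - {j}) l = F r \<tau> l"
    if "r \<in> R" "j \<in> \<tau>" "F r \<tau> j = r" "l \<in> \<tau>" "l \<noteq> j" for r j l
    by (rule F_T[OF assms that])
qed

text \<open>Edges of topes are tree edges. This passes from \<open>T\<close> to \<open>F\<close>,
  and \<open>F_T\<close> passes back.\<close>

lemma F_eq_T:
  "\<lbrakk>\<tau> \<subseteq> L; card \<tau> = Suc (sum u R); m \<in> \<tau>; l \<in> \<tau>; l \<noteq> m; T (\<tau> - {m}) l = r\<rbrakk> \<Longrightarrow> F r \<tau> l = r"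
  using linkage_tree.G_T_eq[OF tree, of \<tau> m l] by simp

lemma F_fibre_nonempty:
  assumes "\<tau> \<subseteq> L" "card \<tau> = Suc (sum u R)" "r \<in> R"
  obtains j where "j \<in> \<tau>" "F r \<tau> j = r"
proof -
  have "card {l \<in> \<tau>. F r \<tau> l = r} \<noteq> 0" using F_card[OF assms] by simp
  then have "{l \<in> \<tau>. F r \<tau> l = r} \<noteq> {}" by force
  then show thesis using that by blast
qed

lemma F_R:
  assumes \<tau>: "\<tau> \<subseteq> L" "card \<tau> = Suc (sum u R)" "r \<in> R" and l: "l \<in> \<tau>"
  shows "F r \<tau> l \<in> R"
proof (cases "F r \<tau> l = r")
  case False
  obtain j where j: "j \<in> \<tau>" "F r \<tau> j = r" using F_fibre_nonempty[OF \<tau>] .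
  then have "l \<noteq> j" using False by auto
  then show ?thesis
    using F_T[OF \<tau> j l] linkage_tree.T_R[OF tree[OF \<tau>(1,2)] j(1) l] by simp
qed (use \<tau> in simp)

text \<open>Dropping a \<open>j\<close> from the fibre over \<open>r\<close> leaves a tope of type
  \<open>u\<close>, so only that fibre is enlarged.\<close>

lemma F_card_other:
  assumes \<tau>: "\<tau> \<subseteq> L" "card \<tau> = Suc (sum u R)" "r \<in> R" and s: "s \<in> R" "s \<noteq> r"
  shows "card {l \<in> \<tau>. F r \<tau> l = s} = u s"
proof -
  obtain j where j: "j \<in> \<tau>" "F r \<tau> j = r" using F_fibre_nonempty[OF \<tau>] .
  have "{l \<in> \<tau>. F r \<tau> l = s} = {l \<in> \<tau> - {j}. T (\<tau> - {j}) l = s}"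
    using F_T[OF \<tau> j] j s by auto
  then show ?thesis using linkage_tree.T_card[OF tree[OF \<tau>(1,2)] j(1) s(1)] by simp
qed

lemma F_takes_value:
  assumes \<tau>: "\<tau> \<subseteq> L" "card \<tau> = Suc (sum u R)" "r \<in> R" and s: "s \<in> R"
  obtains j where "j \<in> \<tau>" "F r \<tau> j = s"
proof -
  have "card {l \<in> \<tau>. F r \<tau> l = s} \<noteq> 0"
    using F_card[OF \<tau>] F_card_other[OF \<tau> s] u_pos[OF s] by (cases "s = r") auto
  then have "{l \<in> \<tau>. F r \<tau> l = s} \<noteq> {}" by force
  then show thesis using that by blast
qed

section \<open>Extended topes are again linked\<close>

text \<open>The completion \<open>g\<close> is \<open>H i q\<close> or \<open>H r q\<close> with the
  value \<open>i\<close> added at a suitable \<open>q\<close>. For \<open>j\<close> in its fibre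
  over \<open>r\<close>, it suffices that \<open>H i j q = i\<close>: then \<open>H i j\<close> and
  \<open>g\<close> both restrict to \<open>W j q\<close>.\<close>

lemma completion_exists:
  assumes i: "i \<in> R" and \<tau>: "\<tau> \<subseteq> L" "card \<tau> = Suc (Suc (sum u R))" and r: "r \<in> R"
  shows "\<exists>g. card {l \<in> \<tau>. g l = r} = Suc ((u(i := Suc (u i))) r) \<and>
    (\<forall>j\<in>\<tau>. g j = r \<longrightarrow> (\<forall>l\<in>\<tau> - {j}. F i (\<tau> - {j}) l = g l))"
proof -
  define H where "H = (\<lambda>r p. F r (\<tau> - {p}))"
  define W where "W = (\<lambda>p q. T (\<tau> - {p} - {q}))"
  have finite_\<tau>: "finite \<tau>" using \<tau> finite_L finite_subset by blast
  have del: "\<tau> - {p} \<subseteq> L" "card (\<tau> - {p}) = Suc (sum u R)" if "p \<in> \<tau>" for p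
    using that \<tau> finite_\<tau> by auto
  \<comment> \<open>The tope \<open>W p q\<close> belongs to the trees of both
    \<open>\<tau> - {p}\<close> and \<open>\<tau> - {q}\<close>; through it facts pass from one tree
    to the other.\<close>
  have W_sym: "W p q = W q p" for p q
    by (simp add: W_def Diff_insert2[symmetric] insert_commute)
  have H_W: "H c p l = c" if "p \<in> \<tau>" "q \<in> \<tau>" "l \<in> \<tau>" "q \<noteq> p" "l \<noteq> p" "l \<noteq> q" "W p q l = c" for c p q l
    using F_eq_T[OF del[OF that(1)], of q l c] that by (simp add: H_def W_def)
  have W_H: "W p q l = H c p l"
    if "c \<in> R" "p \<in> \<tau>" "q \<in> \<tau>" "l \<in> \<tau>" "q \<noteq> p" "l \<noteq> p" "l \<noteq> q" "H c p q = c" for c p q l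
    using F_T[OF del[OF that(2)] that(1), of q l] that by (simp add: H_def W_def)
  have H_card: "card {l \<in> \<tau> - {p}. H c p l = c} = Suc (u c)" if "c \<in> R" "p \<in> \<tau>" for c p
    using F_card[OF del[OF that(2)] that(1)] by (simp add: H_def)
  have "\<tau> \<noteq> {}" using \<tau> by auto
  then obtain s where s: "s \<in> \<tau>" by blast
  show ?thesis
  proof (cases "r = i")
    case True
    let ?S = "{l \<in> \<tau> - {s}. H i s l = i}"
    \<comment> \<open>As \<open>u i\<close> is positive, \<open>i\<close> has two neighbours in the
      tree of \<open>\<tau> - {s}\<close>.\<close>
    have "card ?S \<ge> 2" using H_card[OF i s] u_pos[OF i] by simp
    then obtain p q where pq: "p \<in> \<tau>" "q \<in> \<tau>" "p \<noteq> s" "q \<noteq> s" "p \<noteq> q" "H i s p = i" "H i s q = i"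
      by (auto simp: numeral_2_eq_2 card_le_Suc_iff)
    have q: "H i p q = i"
      by (rule H_W[of p s]) (use W_H[of i s p q] W_sym i pq s in auto)
    have p: "H i q p = i"
      by (rule H_W[of q s]) (use W_H[of i s q p] W_sym i pq s in auto)
    have Hp: "H i p l = W p q l" and Hq: "H i q l = W p q l" if "l \<in> \<tau>" "l \<noteq> p" "l \<noteq> q" for l
      using W_H[of i p q l] W_H[of i q p l] W_sym p q pq i that by auto
    \<comment> \<open>Off \<open>p\<close> and \<open>q\<close>, both \<open>H i p\<close> and
      \<open>H i q\<close> equal \<open>W p q\<close>; since \<open>H i p q = i\<close> and
      \<open>H i q p = i\<close>, one \<open>g\<close> extends both.\<close>
    define g where "g = (\<lambda>l. if l = q then i else H i q l)"
    have g: "g p = i" "g q = i" using p pq by (auto simp: g_def)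
    have "{l \<in> \<tau>. g l = i} = insert q {l \<in> \<tau> - {q}. H i q l = i}"
      using pq by (auto simp: g_def)
    then have "card {l \<in> \<tau>. g l = i} = Suc (Suc (u i))"
      using H_card[of i q] i pq finite_\<tau> by simp
    moreover have "H i j l = g l" if j: "j \<in> \<tau>" "g j = i" and l: "l \<in> \<tau>" "l \<noteq> j" for j l
    proof -
      consider "j = q" | "j = p" | "j \<noteq> p" "j \<noteq> q" by blast
      then show ?thesis
      proof cases
        case 1
        then show ?thesis using l by (simp add: g_def)
      next
        case 2
        then show ?thesis using l g q Hp Hq by (cases "l = q") (auto simp: g_def)
      next
        case 3
        then have jW: "H i p j = i" "H i q j = i" using j Hp Hq by (auto simp: g_def)
        have "W p j q = i" using W_H[of i p j q] jW q i pq j 3 by auto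
        then have jq: "H i j q = i" using H_W[of j p q] W_sym[of p j] pq j 3 by auto
        show ?thesis
        proof (cases "l = q")
          case True
          then show ?thesis using jq by (simp add: g_def)
        next
          case False
          have "H i j l = W j q l" using W_H[of i j q l] i j l pq 3 False jq by auto
          also have "\<dots> = H i q l" using W_H[of i q j l] W_sym i j l pq 3 False jW by auto
          finally show ?thesis using False by (simp add: g_def)
        qed
      qed
    qed
    ultimately show ?thesis using True by (intro exI[of _ g]) (auto simp: H_def)
  next
    case False
    \<comment> \<open>In the tree of \<open>\<tau> - {s}\<close>, \<open>H c s\<close> sends each
      left node towards \<open>c\<close>. So \<open>q\<close> is a neighbour of \<open>i\<close> on
      the side away from \<open>r\<close>, and \<open>p\<close> a neighbour of \<open>r\<close> on
      the side away from \<open>i\<close>.\<close>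
    obtain q where q: "q \<in> \<tau>" "q \<noteq> s" "H r s q = i"
      using F_takes_value[OF del[OF s] r i] unfolding H_def by blast
    obtain p where p: "p \<in> \<tau>" "p \<noteq> s" "H i s p = r"
      using F_takes_value[OF del[OF s] i r] unfolding H_def by blast
    have S: "H i s q = i" "H r s p = r"
    proof -
      obtain j where "j \<in> \<tau>" "j \<noteq> s" "H r s j = r"
        using F_fibre_nonempty[OF del[OF s] r] unfolding H_def by blast
      moreover from this have "j \<noteq> q" using q False by auto
      ultimately show "H i s q = i"
        using W_H[of r s j q] H_W[of s j q i] q s r False by auto
      obtain j where "j \<in> \<tau>" "j \<noteq> s" "H i s j = i"
        using F_fibre_nonempty[OF del[OF s] i] unfolding H_def by blast
      moreover from this have "j \<noteq> p" using p False by auto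
      ultimately show "H r s p = r"
        using W_H[of i s j p] H_W[of s j p r] p s i False by auto
    qed
    have pq: "p \<noteq> q" using S p False by auto
    have Wsp: "W s p q = i" using W_H[of r s p q] S p q s r pq by auto
    have Wsq: "W s q p = r" using W_H[of i s q p] S p q s i pq by auto
    have qp: "H i p q = i" using H_W[of p s q i] W_sym[of s p] Wsp p q s pq by auto
    have pq': "H r q p = r" using H_W[of q s p r] W_sym[of s q] Wsq p q s pq by auto
    define g where "g = (\<lambda>l. if l = q then i else H r q l)"
    have "{l \<in> \<tau>. g l = r} = {l \<in> \<tau> - {q}. H r q l = r}"
      using False by (auto simp: g_def)
    then have "card {l \<in> \<tau>. g l = r} = Suc (u r)" using H_card[of r q] r q by simp
    moreover have "H i j l = g l" if j: "j \<in> \<tau>" "g j = r" and l: "l \<in> \<tau>" "l \<noteq> j" for j l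
    proof -
      have jq: "j \<noteq> q" "H r q j = r" using j False by (auto simp: g_def split: if_splits)
      have "H i j q = i"
      proof (rule ccontr)
        assume no: "H i j q \<noteq> i"
        \<comment> \<open>Otherwise \<open>q\<close> would lie between \<open>j\<close> and
          \<open>s\<close> in the tree of \<open>\<tau> - {p}\<close>, and \<open>T_switch\<close>
          would give \<open>W p s j = W p q j = r\<close>. Then \<open>H r s j = r\<close>, so
          \<open>W s j q = H r s q = i\<close>, which yields \<open>H i j q = i\<close> after
          all.\<close>
        have js: "j \<noteq> s" "j \<noteq> p" using no S qp by auto
        have "W p j q \<noteq> i" using no H_W[of j p q i] W_sym[of p j] j jq js p q pq by auto
        moreover have "W p s q = i" using Wsp W_sym by metis
        ultimately have "W p s j = W p q j"
          using linkage_tree.T_switch[OF tree[OF del[OF p(1)]], of s j q] s j q jq js p pq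
          by (simp add: W_def)
        also have "\<dots> = r" using W_H[of r q p j] W_sym[of p q] pq' jq js j p q r pq by auto
        finally have "H r s j = r" using H_W[of s p j r] W_sym[of p s] j js s p by auto
        then have "W s j q = i" using W_H[of r s j q] q r s j js jq by auto
        then show False using no H_W[of j s q i] W_sym[of s j] j js jq s q by auto
      qed
      note ji = this
      show ?thesis
      proof (cases "l = q")
        case True
        then show ?thesis using ji by (simp add: g_def)
      next
        case lq: False
        have "H i j l = W j q l" using W_H[of i j q l] i j l q jq lq ji by auto
        also have "\<dots> = H r q l" using W_H[of r q j l] W_sym r j l q jq lq by auto
        finally show ?thesis using lq by (simp add: g_def)
      qed
    qed
    ultimately show ?thesis using False by (intro exI[of _ g]) (auto simp: H_def)
  qed
qed

lemma sum_upd: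
  assumes "i \<in> R"
  shows "sum (u(i := Suc (u i))) R = Suc (sum u R)"
  using assms finite_R by (simp add: sum.remove)

lemma amalgamate:
  assumes i: "i \<in> R"
  shows "\<exists>F'. linked_field L R (u(i := Suc (u i))) (F i) F'"
proof -
  let ?u = "u(i := Suc (u i))"
  let ?P = "\<lambda>r \<tau> g. card {l \<in> \<tau>. g l = r} = Suc (?u r) \<and>
    (\<forall>j\<in>\<tau>. g j = r \<longrightarrow> (\<forall>l\<in>\<tau> - {j}. F i (\<tau> - {j}) l = g l))"
  define F' where "F' = (\<lambda>r \<tau>. SOME g. ?P r \<tau> g)"
  have F': "?P r \<tau> (F' r \<tau>)" if "\<tau> \<subseteq> L" "card \<tau> = Suc (sum ?u R)" "r \<in> R" for r \<tau>
    unfolding F'_def using that completion_exists[OF i that(1) _ that(3)] sum_upd[OF i]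
    by (intro someI_ex[of "?P r \<tau>"]) simp
  have "linked_field L R ?u (F i) F'"
  proof
    show "0 < ?u r" if "r \<in> R" for r using u_pos[OF that] by simp
    show "F i \<sigma> l \<in> R" if "\<sigma> \<subseteq> L" "card \<sigma> = sum ?u R" "l \<in> \<sigma>" for \<sigma> l
      using F_R[OF that(1) _ i that(3)] that sum_upd[OF i] by simp
    show "card {l \<in> \<sigma>. F i \<sigma> l = r} = ?u r" if "\<sigma> \<subseteq> L" "card \<sigma> = sum ?u R" "r \<in> R" for \<sigma> r
      using F_card[OF that(1) _ i] F_card_other[OF that(1) _ i that(3)] that sum_upd[OF i] by simp
  qed (use F' finite_L finite_R in auto)
  then show ?thesis by blast
qed

end

section \<open>Surjectivity by induction on the degrees\<close>

text \<open>The sum condition makes \<open>L - \<rho>\<close> one element short of the domain of a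
  tope. Each step trades a unit of \<open>v i\<close> for one of \<open>u i\<close>.\<close>

lemma covector_surj:
  assumes "linked_field L R u T F" and "sum u R + sum v R = Suc (card L)"
  shows "\<exists>\<rho>\<subseteq>L. card \<rho> = sum v R \<and> (\<forall>r\<in>R. card {l \<in> \<rho>. T (insert l (L - \<rho>)) l = r} = v r)"
  using assms
proof (induction "sum v R" arbitrary: u v T F)
  case 0
  then interpret linked_field L R u T F by simp
  show ?case using 0 finite_R by (intro exI[of _ "{}"]) auto
next
  case (Suc k)
  interpret linked_field L R u T F by (rule Suc.prems)
  obtain i where i: "i \<in> R" "0 < v i"
    using Suc.hyps(2) by (metis gr0I nat.distinct(1) sum.neutral)
  let ?u = "u(i := Suc (u i))" and ?v = "v(i := v i - 1)"
  have sv: "sum v R = Suc (sum ?v R)" using i finite_R by (simp add: sum.remove)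
  obtain F' where F': "linked_field L R ?u (F i) F'" using amalgamate[OF i(1)] by blast
  have "sum ?u R + sum ?v R = Suc (card L)" using sum_upd[OF i(1)] sv Suc.prems by simp
  then obtain \<rho> where \<rho>: "\<rho> \<subseteq> L" "card \<rho> = sum ?v R"
    and deg: "\<And>r. r \<in> R \<Longrightarrow> card {l \<in> \<rho>. F i (insert l (L - \<rho>)) l = r} = ?v r"
    using Suc.hyps(1)[OF _ F', of ?v] sv Suc.hyps(2) by auto
  have fin: "finite \<rho>" using \<rho> finite_L finite_subset by blast
  \<comment> \<open>The smaller \<open>\<rho>\<close> leaves a complement that is itself the domain
    of an old tope; its fibre over \<open>i\<close> supplies the element to add.\<close>
  have c: "card (L - \<rho>) = sum u R"
    using \<rho> finite_L fin Suc.prems sv by (simp add: card_Diff_subset)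
  have "card {l \<in> L - \<rho>. T (L - \<rho>) l = i} \<noteq> 0"
    using T_card[OF _ c i(1)] u_pos[OF i(1)] by simp
  then have "{l \<in> L - \<rho>. T (L - \<rho>) l = i} \<noteq> {}" by (metis (no_types) card.empty)
  then obtain j where j: "j \<in> L" "j \<notin> \<rho>" "T (L - \<rho>) j = i" by blast
  let ?\<rho> = "insert j \<rho>"
  have jj: "insert j (L - ?\<rho>) = L - \<rho>" using j by auto
  have same: "T (insert l (L - ?\<rho>)) l = F i (insert l (L - \<rho>)) l" if "l \<in> \<rho>" for l
  proof -
    let ?\<tau> = "insert l (L - \<rho>)"
    have \<tau>: "?\<tau> \<subseteq> L" "card ?\<tau> = Suc (sum u R)" using that \<rho> c finite_L by auto
    have lj: "l \<noteq> j" using that j by auto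
    have "?\<tau> - {l} = L - \<rho>" using that by auto
    \<comment> \<open>Since \<open>j\<close> lies in the fibre over \<open>i\<close>, deleting it
      from \<open>?\<tau>\<close> preserves the value at \<open>l\<close>.\<close>
    then have "F i ?\<tau> j = i" using F_eq_T[OF \<tau>, of l j i] j lj by auto
    then have "T (?\<tau> - {j}) l = F i ?\<tau> l" using F_T[OF \<tau> i(1), of j l] j lj by auto
    moreover have "?\<tau> - {j} = insert l (L - ?\<rho>)" using lj by auto
    ultimately show ?thesis by simp
  qed
  have "card {l \<in> ?\<rho>. T (insert l (L - ?\<rho>)) l = r} = v r" if r: "r \<in> R" for r
  proof -
    \<comment> \<open>The added \<open>j\<close> contributes only to \<open>i\<close>, restoring the
      degree \<open>v i\<close> from \<open>v i - 1\<close>.\<close>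
    have "{l \<in> ?\<rho>. T (insert l (L - ?\<rho>)) l = r} =
        (if r = i then insert j else id) {l \<in> \<rho>. F i (insert l (L - \<rho>)) l = r}"
      using same jj j by auto
    then show ?thesis using deg[OF r] fin j i by auto
  qed
  then show ?case using \<rho> j fin sv by (intro exI[of _ ?\<rho>]) auto
qed

section \<open>Matchings as topes of type all ones\<close>

definition match :: "(nat \<times> nat) set \<Rightarrow> nat \<Rightarrow> nat" where
  "match E l = (THE r. (l, r) \<in> E)"

lemma perfect_matchingD:
  assumes "perfect_matching \<sigma> R E"
  shows "E \<subseteq> \<sigma> \<times> R" "l \<in> \<sigma> \<Longrightarrow> \<exists>!r. (l, r) \<in> E" "r \<in> R \<Longrightarrow> \<exists>!l. (l, r) \<in> E"
  using assms unfolding perfect_matching_def by blast+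

lemma match_iff:
  assumes "perfect_matching \<sigma> R E" "l \<in> \<sigma>"
  shows "(l, r) \<in> E \<longleftrightarrow> match E l = r"
proof -
  have "\<exists>!r. (l, r) \<in> E" using perfect_matchingD(2)[OF assms] .
  from theI'[OF this] this show ?thesis unfolding match_def by blast
qed

lemma match_in: "\<lbrakk>perfect_matching \<sigma> R E; l \<in> \<sigma>\<rbrakk> \<Longrightarrow> match E l \<in> R"
  using match_iff[of \<sigma> R E l "match E l"] perfect_matchingD(1) by blast

lemma match_card:
  assumes "perfect_matching \<sigma> R E" "r \<in> R"
  shows "card {l \<in> \<sigma>. match E l = r} = 1"
proof -
  have "{l \<in> \<sigma>. match E l = r} = {l. (l, r) \<in> E}"
    using match_iff[OF assms(1)] perfect_matchingD(1)[OF assms(1)] by blast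
  moreover obtain l where "{l. (l, r) \<in> E} = {l}"
    using perfect_matchingD(3)[OF assms] by blast
  ultimately show ?thesis by simp
qed

text \<open>The two matchings given by linkage differ only at \<open>r\<close>, so each sends the
  node omitted by the other to \<open>r\<close>. Their union is the extension, with fibre exactly
  \<open>{a, b}\<close> over \<open>r\<close>.\<close>

lemma linkage_linked_field:
  assumes link: "linkage n d M"
  shows "\<exists>F. linked_field {0..<n} {0..<d} (\<lambda>_. 1) (\<lambda>\<sigma>. match (M \<sigma>)) F"
proof -
  let ?P = "\<lambda>r \<tau> g. card {l \<in> \<tau>. g l = r} = 2 \<and>
    (\<forall>j\<in>\<tau>. g j = r \<longrightarrow> (\<forall>l\<in>\<tau> - {j}. match (M (\<tau> - {j})) l = g l))"
  have pm: "perfect_matching \<sigma> {0..<d} (M \<sigma>)" if "\<sigma> \<subseteq> {0..<n}" "card \<sigma> = d" for \<sigma>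
    using link that by (simp add: linkage_def matching_field_def)
  have ex: "\<exists>g. ?P r \<tau> g" if \<tau>: "\<tau> \<subseteq> {0..<n}" "card \<tau> = Suc d" and r: "r < d" for r \<tau>
  proof -
    have "\<exists>a\<in>\<tau>. \<exists>b\<in>\<tau>. a \<noteq> b \<and> away_from r (M (\<tau> - {a})) = away_from r (M (\<tau> - {b}))"
      using link \<tau> r unfolding linkage_def by simp
    then obtain a b where ab: "a \<in> \<tau>" "b \<in> \<tau>" "a \<noteq> b"
      and away: "away_from r (M (\<tau> - {a})) = away_from r (M (\<tau> - {b}))"
      by blast
    have fin: "finite \<tau>" using \<tau> finite_subset by blast
    have pma: "perfect_matching (\<tau> - {j}) {0..<d} (M (\<tau> - {j}))" if "j \<in> \<tau>" for j
      using that \<tau> fin by (intro pm) auto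
    let ?a = "match (M (\<tau> - {a}))" and ?b = "match (M (\<tau> - {b}))"
    have edge: "(l, c) \<in> M (\<tau> - {a}) \<longleftrightarrow> (l, c) \<in> M (\<tau> - {b})" if "c \<noteq> r" for l c
    proof -
      have "(l, c) \<in> away_from r (M (\<tau> - {a})) \<longleftrightarrow> (l, c) \<in> away_from r (M (\<tau> - {b}))"
        by (simp only: away)
      then show ?thesis using that by (simp add: away_from_def)
    qed
    have bM: "(b, c) \<notin> M (\<tau> - {b})" and aM: "(a, c) \<notin> M (\<tau> - {a})" for c
      using perfect_matchingD(1)[OF pma[OF ab(1)]] perfect_matchingD(1)[OF pma[OF ab(2)]] by blast+
    \<comment> \<open>An edge from \<open>b\<close> to a node other than \<open>r\<close> would also
      lie in \<open>M (\<tau> - {b})\<close>, which does not touch \<open>b\<close>.\<close>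
    have ar: "?a b = r" using edge[of "?a b" b] bM match_iff[OF pma[OF ab(1)], of b "?a b"] ab by auto
    have br: "?b a = r" using edge[of "?b a" a] aM match_iff[OF pma[OF ab(2)], of a "?b a"] ab by auto
    have same: "?a l = ?b l" if "l \<in> \<tau>" "l \<noteq> a" "l \<noteq> b" for l
      using edge match_iff[OF pma[OF ab(1)], of l] match_iff[OF pma[OF ab(2)], of l] that
      by (metis DiffI singletonD)
    define g where "g = (\<lambda>l. if l = a then r else ?a l)"
    have "{l \<in> \<tau>. g l = r} = insert a {l \<in> \<tau> - {a}. ?a l = r}"
      using ab by (auto simp: g_def)
    then have two: "card {l \<in> \<tau>. g l = r} = 2"
      using match_card[OF pma[OF ab(1)], of r] r fin by simp
    have "{a, b} = {l \<in> \<tau>. g l = r}"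
      using two ab ar fin by (intro card_subset_eq) (auto simp: g_def)
    then have ab_only: "j = a \<or> j = b" if "j \<in> \<tau>" "g j = r" for j using that by auto
    have "match (M (\<tau> - {j})) l = g l" if "j \<in> \<tau>" "g j = r" "l \<in> \<tau> - {j}" for j l
    proof (cases "j = a")
      case True
      then show ?thesis using that by (simp add: g_def)
    next
      case False
      then have "j = b" using ab_only that by blast
      then show ?thesis using that br same[of l] by (cases "l = a") (simp_all add: g_def)
    qed
    then show ?thesis using two by (intro exI[of _ g]) simp
  qed
  define F where "F = (\<lambda>r \<tau>. SOME g. ?P r \<tau> g)"
  have F: "?P r \<tau> (F r \<tau>)" if "\<tau> \<subseteq> {0..<n}" "card \<tau> = Suc d" "r < d" for r \<tau>
    unfolding F_def by (rule someI_ex[OF ex[OF that]])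
  have "linked_field {0..<n} {0..<d} (\<lambda>_. 1) (\<lambda>\<sigma>. match (M \<sigma>)) F"
  proof
    show "match (M \<sigma>) l \<in> {0..<d}"
      if "\<sigma> \<subseteq> {0..<n}" "card \<sigma> = (\<Sum>_\<in>{0..<d}. 1)" "l \<in> \<sigma>" for \<sigma> l
      using match_in[OF pm that(3)] that by simp
    show "card {l \<in> \<sigma>. match (M \<sigma>) l = r} = 1"
      if "\<sigma> \<subseteq> {0..<n}" "card \<sigma> = (\<Sum>_\<in>{0..<d}. 1)" "r \<in> {0..<d}" for \<sigma> r
      using match_card[OF pm that(3)] that by simp
    show "card {l \<in> \<tau>. F r \<tau> l = r} = Suc 1"
      if "\<tau> \<subseteq> {0..<n}" "card \<tau> = Suc (\<Sum>_\<in>{0..<d}. 1)" "r \<in> {0..<d}" for \<tau> r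
      using F[of \<tau> r] that by simp
    show "match (M (\<tau> - {j})) l = F r \<tau> l"
      if "\<tau> \<subseteq> {0..<n}" "card \<tau> = Suc (\<Sum>_\<in>{0..<d}. 1)" "r \<in> {0..<d}"
        "j \<in> \<tau>" "F r \<tau> j = r" "l \<in> \<tau>" "l \<noteq> j" for \<tau> r j l
      using F[of \<tau> r] that by simp
  qed simp_all
  then show ?thesis by blast
qed

section \<open>The degree map on Chow covectors\<close>

lemma right_degree_vector_chow:
  assumes "matching_field n d M" "d \<le> n" "1 \<le> d" "\<rho> \<subseteq> {0..<n}" "card \<rho> = n - d + 1"
  shows "right_degree_vector d (chow_covector n M \<rho>) =
    map (\<lambda>r. card {l \<in> \<rho>. match (M (insert l ({0..<n} - \<rho>))) l = r}) [0..<d]"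
proof -
  have fin: "finite \<rho>" using assms finite_subset by blast
  have "perfect_matching (insert l ({0..<n} - \<rho>)) {0..<d} (M (insert l ({0..<n} - \<rho>)))" if "l \<in> \<rho>" for l
  proof -
    have "card ({0..<n} - \<rho>) = d - 1" using assms fin by (simp add: card_Diff_subset)
    then have "card (insert l ({0..<n} - \<rho>)) = d" using that assms by simp
    moreover have "insert l ({0..<n} - \<rho>) \<subseteq> {0..<n}" using that assms by blast
    ultimately show ?thesis using assms unfolding matching_field_def by blast
  qed
  note iff = match_iff[OF this insertI1]
  have "{l. (l, r) \<in> chow_covector n M \<rho>} =
      {l \<in> \<rho>. match (M (insert l ({0..<n} - \<rho>))) l = r}" for r
    by (auto simp: chow_covector_def iff)
  then show ?thesis by (simp add: right_degree_vector_def)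
qed

theorem theorem3p23:
  fixes n d :: nat and M :: "nat set \<Rightarrow> (nat \<times> nat) set"
  assumes "1 \<le> d" and "d \<le> n" and "linkage n d M"
  shows "bij_betw (\<lambda>\<rho>. right_degree_vector d (chow_covector n M \<rho>))
           {\<rho>. \<rho> \<subseteq> {0..<n} \<and> card \<rho> = n - d + 1}
           {v. length v = d \<and> sum_list v = n - d + 1}"
proof -
  let ?f = "\<lambda>\<rho>. right_degree_vector d (chow_covector n M \<rho>)"
  let ?A = "{\<rho>. \<rho> \<subseteq> {0..<n} \<and> card \<rho> = n - d + 1}"
  let ?B = "{v::nat list. length v = d \<and> sum_list v = n - d + 1}"
  have mf: "matching_field n d M" using assms by (simp add: linkage_def)
  obtain F where F: "linked_field {0..<n} {0..<d} (\<lambda>_. 1) (\<lambda>\<sigma>. match (M \<sigma>)) F"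
    using linkage_linked_field[OF assms(3)] by blast
  have surj: "?B \<subseteq> ?f ` ?A"
  proof
    fix v assume v: "v \<in> ?B"
    have sv: "(\<Sum>r\<in>{0..<d}. v ! r) = n - d + 1"
      using v sum_list_sum_nth[of v] by auto
    then have "(\<Sum>r\<in>{0..<d}. 1) + (\<Sum>r\<in>{0..<d}. v ! r) = Suc (card {0..<n})"
      using assms by simp
    from covector_surj[OF F this] obtain \<rho> where \<rho>: "\<rho> \<in> ?A"
      and deg: "\<And>r. r < d \<Longrightarrow> card {l \<in> \<rho>. match (M (insert l ({0..<n} - \<rho>))) l = r} = v ! r"
      using sv by auto
    have "?f \<rho> = map ((!) v) [0..<d]"
      using right_degree_vector_chow[OF mf] assms \<rho> deg by simp
    also have "\<dots> = v" using v map_nth by auto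
    finally show "v \<in> ?f ` ?A" using \<rho> by blast
  qed
  have finA: "finite ?A" by simp
  have "card ?A = n choose (n - d + 1)" using n_subsets[of "{0..<n}"] by simp
  \<comment> \<open>Stars and bars: the upper index \<open>(n - d + 1) + d - 1\<close> is
    \<open>n\<close>. A surjection between finite sets of equal size is injective.\<close>
  moreover have "card ?B = n choose (n - d + 1)" using card_length_sum_list[of d "n - d + 1"] assms by simp
  ultimately have eq: "card ?A = card ?B" by simp
  have "?f ` ?A = ?B"
  proof -
    have "card (?f ` ?A) \<le> card ?B" using card_image_le[OF finA] eq by simp
    then show ?thesis using card_seteq[OF finite_imageI[OF finA] surj] by simp
  qed
  moreover have "inj_on ?f ?A" using finA eq calculation by (intro eq_card_imp_inj_on) simp_all
  ultimately show ?thesis by (simp add: bij_betw_def)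
qed

end
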